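(* Let $\{H_n\}_{n=1}^\infty$ be a Positive Linear Recurrence Sequence. Then: (a) There is a unique legal decomposition for each positive integer $N$. (b) For each $n\ge 1$ there is a bijection between the set $\mathcal{S}_n$ of integers in $[H_n,H_{n+1})$ and the set $\mathcal{D}_n$ of legal decompositions of the form $\sum_{i=1}^{n} a_i H_{n+1-i}$.
   Context: A Positive Linear Recurrence Sequence is a sequence $\{H_n\}_{n\ge1}$ of positive integers for which there are non-negative integers $L,c_1,\dots,c_L$ with $L,c_1,c_L$ positive such that $H_1=1$, $H_{n+1}=c_1H_n+c_2H_{n-1}+\cdots+c_nH_1+1$ for $1\le n<L$, and $H_{n+1}=c_1H_n+\cdots+c_LH_{n+1-L}$ for $n\ge L$. When $L=1$ it is assumed that $c_1>1$. A decomposition $\sum_{i=1}^{m} a_iH_{m+1-i}$ of a positive integer (and the integer sequence $\{a_i\}_{i=1}^m$) is called legal if $a_1>0$, the other $a_i\ge0$, and one of the following holds. Condition 1: $m<L$ and $a_i=c_i$ for $1\le i\le m$. Condition 2: there exists $s\in\{1,\dots,L\}$ such that $a_1=c_1,\dots,a_{s-1}=c_{s-1}$ and $a_s<c_s$, $a_{s+1}=\cdots=a_{s+\ell}=0$ for some $\ell\ge0$, and the sequence $\{b_i\}_{i=1}^{m-s-\ell}$ with $b_i=a_{s+\ell+i}$ is legal. The empty sequence (representing $0$) counts as legal. *)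

theory Defs
  imports Main
begin

text \<open>
  Sequences are indexed from 1, so the values \<open>H 0\<close>, \<open>c 0\<close> and \<open>c i\<close> for \<open>i > L\<close> are irrelevant.
  The recurrence data \<open>L\<close>, \<open>c\<close> are kept as parameters because legality depends on them
  and not only on \<open>H\<close>.
\<close>

definition plrs :: "nat \<Rightarrow> (nat \<Rightarrow> nat) \<Rightarrow> (nat \<Rightarrow> nat) \<Rightarrow> bool" where
  "plrs L c H \<longleftrightarrow>
     L > 0 \<and> c 1 > 0 \<and> c L > 0 \<and> (L = 1 \<longrightarrow> c 1 > 1) \<and>
     (\<forall>n\<ge>1. H n > 0) \<and>
     H 1 = 1 \<and>
     (\<forall>n. 1 \<le> n \<and> n < L \<longrightarrow> H (n + 1) = (\<Sum>i = 1..n. c i * H (n + 1 - i)) + 1) \<and>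
     (\<forall>n. n \<ge> L \<longrightarrow> H (n + 1) = (\<Sum>i = 1..L. c i * H (n + 1 - i)))"

text \<open>
  A finite sequence \<open>a\<^sub>1, \<dots>, a\<^sub>m\<close> is a list of length \<open>m\<close>; its 1-based entry \<open>a\<^sub>i\<close> is \<open>coef a i\<close>,
  to be used only for \<open>1 \<le> i \<le> m\<close>.
\<close>

abbreviation coef :: "nat list \<Rightarrow> nat \<Rightarrow> nat" where
  "coef a i \<equiv> a ! (i - 1)"

definition decomp_sum :: "(nat \<Rightarrow> nat) \<Rightarrow> nat list \<Rightarrow> nat" where
  "decomp_sum H a = (\<Sum>i = 1..length a. coef a i * H (length a + 1 - i))"

text \<open>
  In \<open>cond2\<close>, the bound \<open>s + l \<le> length a\<close> says that all the entries mentioned exist; the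
  remaining sequence \<open>b\<close> is empty when equality holds.
\<close>

inductive legal :: "nat \<Rightarrow> (nat \<Rightarrow> nat) \<Rightarrow> nat list \<Rightarrow> bool" for L c where
  empty: "legal L c []"
| cond1: "legal L c a"
    if "a \<noteq> []" "coef a 1 > 0"
       "length a < L" "\<forall>i\<in>{1..length a}. coef a i = c i"
| cond2: "legal L c a"
    if "a \<noteq> []" "coef a 1 > 0"
       "s \<in> {1..L}" "s + l \<le> length a"
       "\<forall>i\<in>{1..<s}. coef a i = c i" "coef a s < c s"
       "\<forall>i\<in>{s+1..s+l}. coef a i = 0"
       "legal L c (drop (s + l) a)"

end

theory Submission
  imports Defs
begin

text \<open>
  Read a decomposition from its most significant digit on, and remember only the number \<open>j\<close> of
  digits of the current block that have so far agreed with \<open>c\<^sub>1, c\<^sub>2, \<dots>\<close>. In state \<open>j\<close> the next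
  digit is either smaller than \<open>c\<^sub>j\<^sub>+\<^sub>1\<close>, which closes the block and returns to state \<open>0\<close>, or equal
  to \<open>c\<^sub>j\<^sub>+\<^sub>1\<close>, which leads to state \<open>j + 1\<close>; state \<open>L\<close> is forbidden. The words admitted from
  state \<open>0\<close> are exactly the legal sequences preceded by any number of zeros
  (\<open>legal_iff_admissible\<close>), because \<open>c\<^sub>1 > 0\<close> makes a leading zero a complete block.

  Let \<open>B j m\<close> be the part of the recurrence for \<open>H\<close> that remains after \<open>j\<close> coefficients have been
  used up, with \<open>m\<close> digits still to come. It satisfies
  \<open>B j (m + 1) = c\<^sub>j\<^sub>+\<^sub>1 H\<^sub>m\<^sub>+\<^sub>1 + B (j + 1) m\<close>, and the recurrence says
  \<open>B 0 m = H\<^sub>m\<^sub>+\<^sub>1\<close>. Hence the interval \<open>[0, B j (m + 1))\<close> is tiled by \<open>c\<^sub>j\<^sub>+\<^sub>1\<close> intervals of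
  length \<open>B 0 m\<close>, one for each digit that closes the block, followed by one interval of length
  \<open>B (j + 1) m\<close> for the digit \<open>c\<^sub>j\<^sub>+\<^sub>1\<close>. By induction on \<open>m\<close>, every number below \<open>B j m\<close> is the
  value of exactly one word of length \<open>m\<close> admitted from state \<open>j\<close> (\<open>admissible_ex1\<close>).

  For \<open>j = 0\<close> this gives both claims. Since \<open>H\<close> is unbounded, every \<open>N\<close> is below some \<open>H\<^sub>m\<^sub>+\<^sub>1\<close>;
  padding with zeros compares decompositions of different lengths. A word of length \<open>n\<close> has a
  nonzero first digit exactly when its value is at least \<open>H\<^sub>n\<close>, so evaluation maps the legal
  decompositions of length \<open>n\<close> bijectively onto \<open>[H\<^sub>n, H\<^sub>n\<^sub>+\<^sub>1)\<close>.
\<close>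

section \<open>The recurrence with a used-up prefix\<close>

text \<open>
  The minimum and the conditional summand merge the two cases of the recurrence. State \<open>L\<close> gets
  the value \<open>0\<close>, so it needs no separate treatment below.
\<close>

definition remainder_bound :: "nat \<Rightarrow> (nat \<Rightarrow> nat) \<Rightarrow> (nat \<Rightarrow> nat) \<Rightarrow> nat \<Rightarrow> nat \<Rightarrow> nat" where
  "remainder_bound L c H j m =
     (\<Sum>i = 1..min m (L - j). c (j + i) * H (m + 1 - i)) + (if m + j < L then 1 else 0)"

lemma remainder_bound_0: "remainder_bound L c H j 0 = (if j < L then 1 else 0)"
  by (simp add: remainder_bound_def)

lemma remainder_bound_L: "remainder_bound L c H L m = 0"
  by (simp add: remainder_bound_def)

lemma remainder_bound_Suc:
  assumes "j < L"
  shows "remainder_bound L c H j (Suc m) =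
           c (Suc j) * H (Suc m) + remainder_bound L c H (Suc j) m"
proof -
  have "min (Suc m) (L - j) = Suc (min m (L - Suc j))"
    using assms by simp
  then show ?thesis
    by (simp add: remainder_bound_def sum.atLeast1_atMost_eq sum.lessThan_Suc_shift
        del: sum.cl_ivl_Suc sum.lessThan_Suc)
qed

lemma remainder_bound_start:
  assumes "plrs L c H"
  shows "remainder_bound L c H 0 m = H (Suc m)"
proof (cases "m < L")
  case True
  then show ?thesis
    using assms by (cases "m = 0") (auto simp: remainder_bound_def plrs_def min_def)
next
  case False
  then show ?thesis
    using assms by (auto simp: remainder_bound_def plrs_def min_def)
qed

text \<open>This is where \<open>c\<^sub>L > 0\<close> is used: the last coefficient keeps every remainder alive.\<close>

lemma remainder_bound_pos:
  assumes "plrs L c H" "j < L"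
  shows "remainder_bound L c H j m > 0"
  using assms(2)
proof (induction m arbitrary: j)
  case 0
  then show ?case by (simp add: remainder_bound_0)
next
  case (Suc m)
  show ?case
  proof (cases "Suc j = L")
    case True
    then show ?thesis
      using assms(1) Suc.prems by (auto simp: remainder_bound_Suc plrs_def)
  next
    case False
    then show ?thesis
      using Suc by (simp add: remainder_bound_Suc)
  qed
qed

lemma plrs_less_Suc:
  assumes "plrs L c H" "n \<ge> 1"
  shows "H n < H (Suc n)"
proof -
  obtain m where n: "n = Suc m"
    using assms(2) by (cases n) auto
  have L: "0 < L" and c: "c 1 > 0" "L = 1 \<Longrightarrow> c 1 > 1" and pos: "H n > 0"
    using assms by (auto simp: plrs_def)
  have H: "H (Suc n) = c 1 * H n + remainder_bound L c H 1 m"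
    using remainder_bound_start[OF assms(1), of n] remainder_bound_Suc[OF L, of c H m] n by simp
  show ?thesis
  proof (cases "L = 1")
    case True
    then show ?thesis
      using H c(2) pos by (simp add: remainder_bound_L)
  next
    case False
    then have "remainder_bound L c H 1 m > 0"
      using L assms(1) by (intro remainder_bound_pos) auto
    moreover have "1 * H n \<le> c 1 * H n"
      using c(1) by (intro mult_le_mono1) simp
    ultimately show ?thesis
      using H by linarith
  qed
qed

lemma plrs_gt_index:
  assumes "plrs L c H"
  shows "m < H (Suc m)"
proof (induction m)
  case 0
  then show ?case using assms by (simp add: plrs_def)
next
  case (Suc m)
  then show ?case using plrs_less_Suc[OF assms, of "Suc m"] by simp
qed

section \<open>Admissible words\<close>

fun admissible :: "nat \<Rightarrow> (nat \<Rightarrow> nat) \<Rightarrow> nat \<Rightarrow> nat list \<Rightarrow> bool" where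
  "admissible L c j [] \<longleftrightarrow> j < L"
| "admissible L c j (x # xs) \<longleftrightarrow>
     j < L \<and> (x < c (Suc j) \<and> admissible L c 0 xs \<or> x = c (Suc j) \<and> admissible L c (Suc j) xs)"

lemma decomp_sum_Nil [simp]: "decomp_sum H [] = 0"
  by (simp add: decomp_sum_def)

lemma decomp_sum_Cons [simp]:
  "decomp_sum H (x # xs) = x * H (Suc (length xs)) + decomp_sum H xs"
  by (simp add: decomp_sum_def sum.atLeast1_atMost_eq sum.lessThan_Suc_shift
      del: sum.cl_ivl_Suc sum.lessThan_Suc)

lemma decomp_sum_zeros [simp]: "decomp_sum H (replicate k 0 @ a) = decomp_sum H a"
  by (induction k) auto

lemma admissible_zeros:
  assumes "plrs L c H"
  shows "admissible L c 0 (replicate k 0 @ a) \<longleftrightarrow> admissible L c 0 a"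
  using assms by (induction k) (auto simp: plrs_def)

lemma admissible_less:
  assumes "plrs L c H" "admissible L c j a"
  shows "decomp_sum H a < remainder_bound L c H j (length a)"
  using assms(2)
proof (induction a arbitrary: j)
  case Nil
  then show ?case by (simp add: remainder_bound_0)
next
  case (Cons x xs)
  let ?h = "H (Suc (length xs))"
  from Cons.prems have j: "j < L" by simp
  from Cons.prems consider
    "x < c (Suc j)" "admissible L c 0 xs" | "x = c (Suc j)" "admissible L c (Suc j) xs"
    by auto
  then show ?case
  proof cases
    case 1
    have "decomp_sum H xs < ?h"
      using Cons.IH[OF 1(2)] by (simp add: remainder_bound_start[OF assms(1)])
    then have "decomp_sum H (x # xs) < Suc x * ?h" by simp
    also have "Suc x * ?h \<le> c (Suc j) * ?h"
      using 1(1) by (intro mult_le_mono1) simp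
    finally show ?thesis by (simp add: remainder_bound_Suc[OF j])
  next
    case 2
    then show ?thesis
      using Cons.IH[OF 2(2)] by (simp add: remainder_bound_Suc[OF j])
  qed
qed

corollary admissible_0_less:
  assumes "plrs L c H" "admissible L c 0 a"
  shows "decomp_sum H a < H (Suc (length a))"
  using admissible_less[OF assms] by (simp add: remainder_bound_start[OF assms(1)])

text \<open>
  The tiling argument: comparing \<open>N\<close> with \<open>c\<^sub>j\<^sub>+\<^sub>1 H\<^sub>m\<^sub>+\<^sub>1\<close> decides whether the first digit closes the
  block, and if it does, the digit and the value of the rest are quotient and remainder of \<open>N\<close> by
  \<open>H\<^sub>m\<^sub>+\<^sub>1\<close>.
\<close>

lemma admissible_ex1:
  assumes "plrs L c H" "j \<le> L" "N < remainder_bound L c H j m"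
  shows "\<exists>!a. length a = m \<and> admissible L c j a \<and> decomp_sum H a = N"
  using assms(2,3)
proof (induction m arbitrary: j N)
  case 0
  then show ?case by (auto simp: remainder_bound_0 split: if_splits)
next
  case (Suc m)
  let ?h = "H (Suc m)"
  have j: "j < L"
    using Suc.prems remainder_bound_L[of L c H "Suc m"] by (cases "j = L") auto
  have h: "?h > 0"
    using assms(1) by (simp add: plrs_def)
  have lt: "decomp_sum H xs < ?h" if "length xs = m" "admissible L c 0 xs" for xs
    using admissible_0_less[OF assms(1) that(2)] that(1) by simp
  have tile: "x * ?h + decomp_sum H xs < c (Suc j) * ?h"
    if "length xs = m" "admissible L c 0 xs" "x < c (Suc j)" for x xs
  proof -
    have "x * ?h + decomp_sum H xs < Suc x * ?h"
      using lt[OF that(1,2)] by simp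
    also have "\<dots> \<le> c (Suc j) * ?h"
      using that(3) by (intro mult_le_mono1) simp
    finally show ?thesis .
  qed
  show ?case
  proof (cases "N < c (Suc j) * ?h")
    case True
    have "N mod ?h < remainder_bound L c H 0 m"
      using h by (simp add: remainder_bound_start[OF assms(1)])
    from Suc.IH[OF le0 this] obtain xs where
      xs: "length xs = m" "admissible L c 0 xs" "decomp_sum H xs = N mod ?h" and
      uniq: "\<And>ys. length ys = m \<Longrightarrow> admissible L c 0 ys \<Longrightarrow> decomp_sum H ys = N mod ?h \<Longrightarrow> ys = xs"
      by (elim ex1E) blast
    have digit: "N div ?h < c (Suc j)"
      using True h by (simp add: div_less_iff_less_mult)
    show ?thesis
    proof (intro ex1I[of _ "N div ?h # xs"], goal_cases)
      case 1
      then show ?case using xs digit j by simp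
    next
      case (2 b)
      then obtain y ys where b: "b = y # ys" "length ys = m"
        by (auto simp: length_Suc_conv)
      have val: "y * ?h + decomp_sum H ys = N"
        using 2 b by simp
      have "y \<noteq> c (Suc j)"
        using val True by auto
      then have ys: "admissible L c 0 ys"
        using 2 b by auto
      have "decomp_sum H ys = N mod ?h" "y = N div ?h"
        using lt[OF b(2) ys] val h by auto
      then show ?case
        using uniq[OF b(2) ys] b(1) by simp
    qed
  next
    case False
    let ?r = "N - c (Suc j) * ?h"
    have "?r < remainder_bound L c H (Suc j) m"
      using Suc.prems(2) False by (simp add: remainder_bound_Suc[OF j])
    from Suc.IH[OF Suc_leI[OF j] this] obtain xs where
      xs: "length xs = m" "admissible L c (Suc j) xs" "decomp_sum H xs = ?r" and
      uniq: "\<And>ys. length ys = m \<Longrightarrow> admissible L c (Suc j) ys \<Longrightarrow> decomp_sum H ys = ?r \<Longrightarrow> ys = xs"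
      by (elim ex1E) blast
    show ?thesis
    proof (intro ex1I[of _ "c (Suc j) # xs"], goal_cases)
      case 1
      then show ?case using xs j False by simp
    next
      case (2 b)
      then obtain y ys where b: "b = y # ys" "length ys = m"
        by (auto simp: length_Suc_conv)
      have val: "y * ?h + decomp_sum H ys = N"
        using 2 b by simp
      have "\<not> (y < c (Suc j) \<and> admissible L c 0 ys)"
        using tile[OF b(2)] val False by auto
      then have y: "y = c (Suc j)" and ys: "admissible L c (Suc j) ys"
        using 2 b by auto
      have "decomp_sum H ys = ?r"
        using val y by auto
      then show ?case
        using uniq[OF b(2) ys] b(1) y by simp
    qed
  qed
qed

section \<open>Legality as admissibility\<close>

text \<open>
  The first alternative is the unfinished block of condition 1, the second the finished block of
  condition 2 with \<open>s = t + 1\<close>. For \<open>j = 0\<close> the zeros that condition 2 allows after the block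
  are part of the admissible rest.
\<close>

lemma admissible_block_iff:
  "admissible L c j a \<longleftrightarrow>
     length a + j < L \<and> (\<forall>i<length a. a ! i = c (Suc (j + i))) \<or>
     (\<exists>t<length a. j + t < L \<and> (\<forall>i<t. a ! i = c (Suc (j + i))) \<and> a ! t < c (Suc (j + t)) \<and>
        admissible L c 0 (drop (Suc t) a))"
proof (induction a arbitrary: j)
  case Nil
  then show ?case by simp
next
  case (Cons x xs)
  show ?case
    unfolding admissible.simps Cons.IH[of "Suc j"]
    by (auto simp: All_less_Suc2 Ex_less_Suc2)
qed

lemma admissible_if_legal:
  assumes "plrs L c H" "legal L c a"
  shows "admissible L c 0 a"
  using assms(2)
proof (induction rule: legal.induct)
  case empty
  then show ?case using assms(1) by (simp add: plrs_def)
next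
  case (cond1 a)
  have "a ! i = c (Suc i)" if "i < length a" for i
    using cond1(4)[rule_format, of "Suc i"] that by simp
  then show ?case
    using cond1(3) by (subst admissible_block_iff) simp
next
  case (cond2 a s l)
  have pre: "a ! i = c (Suc i)" if "i < s - 1" for i
    using cond2(5)[rule_format, of "Suc i"] that by simp
  have "drop s a = replicate l 0 @ drop (s + l) a"
  proof (rule nth_equalityI, goal_cases)
    case 1
    then show ?case using cond2(4) by simp
  next
    case (2 i)
    then show ?case
      using cond2(4) cond2(7)[rule_format, of "Suc (s + i)"]
      by (auto simp: nth_append)
  qed
  then have "admissible L c 0 (drop s a)"
    using cond2.IH admissible_zeros[OF assms(1)] by simp
  then show ?case
    using cond2(3,4,6) pre
    by (subst admissible_block_iff) (auto intro!: exI[of _ "s - 1"])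
qed

lemma zeros_split:
  obtains b :: "'a :: zero list" and k where "a = replicate k 0 @ b" "b \<noteq> [] \<Longrightarrow> hd b \<noteq> 0"
proof
  have "takeWhile (\<lambda>x. x = 0) a = replicate (length (takeWhile (\<lambda>x. x = 0) a)) 0"
    by (rule replicate_eqI) (auto dest: set_takeWhileD)
  then show "a = replicate (length (takeWhile (\<lambda>x. x = 0) a)) 0 @ dropWhile (\<lambda>x. x = 0) a"
    by (metis takeWhile_dropWhile_id)
  show "dropWhile (\<lambda>x. x = 0) a \<noteq> [] \<Longrightarrow> hd (dropWhile (\<lambda>x. x = 0) a) \<noteq> 0"
    by (rule hd_dropWhile)
qed

lemma legal_if_admissible:
  assumes "plrs L c H" "admissible L c 0 a" "a \<noteq> [] \<Longrightarrow> hd a > 0"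
  shows "legal L c a"
  using assms(2,3)
proof (induction a rule: length_induct)
  case (1 a)
  show ?case
  proof (cases "a = []")
    case True
    then show ?thesis by (simp add: legal.empty)
  next
    case False
    then have a1: "coef a 1 > 0"
      using 1(3) by (simp add: hd_conv_nth)
    from 1(2) consider
      (unfinished) "length a < L" "\<forall>i<length a. a ! i = c (Suc i)"
    | (finished) t where "t < length a" "t < L" "\<forall>i<t. a ! i = c (Suc i)" "a ! t < c (Suc t)"
        "admissible L c 0 (drop (Suc t) a)"
      by (subst (asm) admissible_block_iff) auto
    then show ?thesis
    proof cases
      case unfinished
      have "coef a i = c i" if "i \<in> {1..length a}" for i
        using unfinished(2)[rule_format, of "i - 1"] that by auto
      then show ?thesis
        using False a1 unfinished(1) by (intro legal.cond1) auto
    next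
      case finished
      obtain k b where b: "drop (Suc t) a = replicate k 0 @ b" "b \<noteq> [] \<Longrightarrow> hd b \<noteq> 0"
        using zeros_split[of "drop (Suc t) a"] by blast
      have len: "length a = Suc t + k + length b"
        using arg_cong[OF b(1), of length] finished(1) by simp
      have drop: "drop (Suc t + k) a = b"
        using arg_cong[OF b(1), of "drop k"] by (simp add: add.commute)
      have "admissible L c 0 b"
        using finished(5) admissible_zeros[OF assms(1)] b(1) by simp
      then have rest: "legal L c (drop (Suc t + k) a)"
        using 1(1) len b(2) unfolding drop by auto
      have zero: "coef a i = 0" if "i \<in> {Suc t + 1..Suc t + k}" for i
      proof -
        have "a ! (i - 1) = drop (Suc t) a ! (i - 1 - Suc t)"
          using that len by (subst nth_drop) (auto intro: arg_cong[of _ _ "nth a"])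
        also have "\<dots> = 0"
          using that unfolding b(1) by (auto simp: nth_append)
        finally show ?thesis .
      qed
      have match: "coef a i = c i" if "i \<in> {1..<Suc t}" for i
        using finished(3)[rule_format, of "i - 1"] that by auto
      show ?thesis
      proof (rule legal.cond2[OF False a1 _ _ _ _ _ rest])
        show "Suc t \<in> {1..L}" "Suc t + k \<le> length a" "coef a (Suc t) < c (Suc t)"
          using finished(2,4) len by simp_all
        show "\<forall>i\<in>{1..<Suc t}. coef a i = c i" "\<forall>i\<in>{Suc t + 1..Suc t + k}. coef a i = 0"
          using match zero by blast+
      qed
    qed
  qed
qed

lemma legal_hd_pos: "legal L c a \<Longrightarrow> a \<noteq> [] \<Longrightarrow> hd a > 0"
  by (erule legal.cases) (auto simp: hd_conv_nth)

lemma legal_iff_admissible: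
  assumes "plrs L c H"
  shows "legal L c a \<longleftrightarrow> admissible L c 0 a \<and> (a \<noteq> [] \<longrightarrow> hd a > 0)"
  using admissible_if_legal[OF assms] legal_if_admissible[OF assms] legal_hd_pos by blast

section \<open>Existence, uniqueness and the bijection\<close>

lemma legal_ex:
  assumes "plrs L c H"
  obtains a where "legal L c a" "decomp_sum H a = N"
proof -
  have "N < remainder_bound L c H 0 N"
    using plrs_gt_index[OF assms] by (simp add: remainder_bound_start[OF assms])
  from admissible_ex1[OF assms le0 this]
  obtain w where w: "admissible L c 0 w" "decomp_sum H w = N"
    by blast
  obtain k b where b: "w = replicate k 0 @ b" "b \<noteq> [] \<Longrightarrow> hd b \<noteq> 0"
    using zeros_split[of w] by blast
  have "admissible L c 0 b"
    using w(1) admissible_zeros[OF assms] b(1) by simp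
  then show ?thesis
    using that[of b] w(2) b legal_iff_admissible[OF assms] by auto
qed

text \<open>
  Padding the shorter of the two words with zeros keeps it admissible and keeps its value, so it
  becomes equal to the longer one; as the longer one does not start with a zero, there was nothing
  to pad.
\<close>

lemma legal_unique:
  assumes "plrs L c H" "legal L c a" "legal L c b" "decomp_sum H a = decomp_sum H b"
  shows "a = b"
  using assms(2-4)
proof (induction "length a" "length b" arbitrary: a b rule: linorder_wlog)
  case le
  let ?a = "replicate (length b - length a) 0 @ a"
  have b: "admissible L c 0 b" and a: "admissible L c 0 ?a"
    using le legal_iff_admissible[OF assms(1)] admissible_zeros[OF assms(1)] by auto
  have "decomp_sum H b < remainder_bound L c H 0 (length b)"
    using admissible_less[OF assms(1) b] .
  then have "\<exists>!w. length w = length b \<and> admissible L c 0 w \<and> decomp_sum H w = decomp_sum H b"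
    using admissible_ex1[OF assms(1)] by blast
  then have eq: "?a = b"
    using a b le by auto
  have "length b - length a = 0"
  proof (rule ccontr)
    assume "length b - length a \<noteq> 0"
    then have "b \<noteq> []" "hd b = 0"
      using eq[symmetric] by (cases "length b - length a"; simp)+
    then show False
      using legal_hd_pos[OF le(3)] by simp
  qed
  then show ?case using eq by simp
next
  case sym
  then show ?case by metis
qed

lemma legal_bij_betw_decomp_sum:
  assumes "plrs L c H" "n \<ge> 1"
  shows "bij_betw (decomp_sum H) {a. length a = n \<and> legal L c a} {H n..<H (Suc n)}"
proof (intro bij_betw_imageI inj_onI equalityI subsetI, goal_cases)
  case (1 a b)
  then show ?case using legal_unique[OF assms(1)] by blast
next
  case (2 N)
  then obtain a where a: "length a = n" "legal L c a" "N = decomp_sum H a"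
    by auto
  then obtain x xs where x: "a = x # xs"
    using assms(2) by (cases a) auto
  have "x > 0"
    using legal_hd_pos[OF a(2)] x by simp
  then have "H n \<le> x * H n"
    by simp
  also have "\<dots> \<le> N"
    using a x by auto
  finally have "H n \<le> N" .
  moreover have "N < H (Suc n)"
    using admissible_0_less[OF assms(1)] admissible_if_legal[OF assms(1)] a by blast
  ultimately show ?case by simp
next
  case (3 N)
  then have "N < remainder_bound L c H 0 n"
    by (simp add: remainder_bound_start[OF assms(1)])
  from admissible_ex1[OF assms(1) le0 this]
  obtain w where w: "length w = n" "admissible L c 0 w" "decomp_sum H w = N"
    by blast
  \<comment> \<open>A leading zero would leave an admissible word of length \<open>n - 1\<close>, whose value is below \<open>H n\<close>.\<close>
  have "hd w > 0"
  proof (rule ccontr)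
    assume "\<not> hd w > 0"
    then obtain xs where xs: "w = replicate 1 0 @ xs"
      using w(1) assms(2) by (cases w) auto
    then have "admissible L c 0 xs"
      using w(2) admissible_zeros[OF assms(1)] by metis
    then have "decomp_sum H xs < H n"
      using admissible_0_less[OF assms(1)] w(1) xs by fastforce
    then show False
      using 3 w(3) xs by simp
  qed
  then have "legal L c w"
    using legal_iff_admissible[OF assms(1)] w(2) by blast
  then show ?case using w by auto
qed

theorem theorem1p1:
  fixes L :: nat and c H :: "nat \<Rightarrow> nat"
  assumes "plrs L c H"
  shows "(\<forall>N>0. \<exists>!a. legal L c a \<and> decomp_sum H a = N) \<and>
         (\<forall>n\<ge>1. \<exists>f. bij_betw f {H n..<H (n + 1)} {a. length a = n \<and> legal L c a})"
proof (intro conjI allI impI)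
  fix N :: nat
  show "\<exists>!a. legal L c a \<and> decomp_sum H a = N"
    using legal_ex[OF assms] legal_unique[OF assms] by metis
next
  fix n :: nat
  assume "n \<ge> 1"
  then show "\<exists>f. bij_betw f {H n..<H (n + 1)} {a. length a = n \<and> legal L c a}"
    using bij_betw_inv_into[OF legal_bij_betw_decomp_sum[OF assms]] by auto
qed

end
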